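(* Let $r\ge1$ and $n>r$ be integers, let $E_j=[\alpha_j,\beta_j]\subseteq[0,2\pi)$, $j=1,\dots,r$, be pairwise disjoint intervals of equal length $\Delta=\beta_j-\alpha_j>0$, and assume $\Delta\notin\pi\mathbb Q$. Let $\Phi_{\vec n}$ be the type II multiple orthogonal polynomial on the unit circle for the multi-index $\vec n=(n-r,1,\dots,1)\in\mathbb N^{r+1}$ and the weights $\omega^{(1)}(e^{i\theta})=1$, $\omega^{(j+1)}(e^{i\theta})=\mathbf 1_{E_j}(\theta)$, $j=1,\dots,r$. Then $$\Phi_{\vec n}(z)=z^n-\sum_{q=1}^r\left(\frac{a_n}{a_{l_q}}(-1)^{r-q}e_{r-q+1}(x_1,\dots,x_r)\right)z^{l_q}.$$ Moreover, $\Phi_{\vec n}$ has a zero of multiplicity $n-r$ at the origin and $r$ further zeros $\zeta_1,\dots,\zeta_r\in\mathbb C$ (counted with multiplicity), and for every $q=1,\dots,r$, $$\max_{1\le j\le r}|\zeta_j|\ge\left(\left|\frac{n-r+q-1}{n}\,\frac{\sin\left(\frac{n\Delta}2\right)}{\sin\left(\frac{(n-r+q-1)\Delta}2\right)}\right|\frac{|e_{r-q+1}(x_1,\dots,x_r)|}{\binom r{q-1}}\right)^{\frac1{r-q+1}}.$$ In particular (case $q=1$), $$\max_{1\le j\le r}|\zeta_j|\ge\left|\frac{n-r}{n}\,\frac{\sin\left(\frac{n\Delta}2\right)}{\sin\left(\frac{(n-r)\Delta}2\right)}\right|^{\frac1r}.$$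
   Context: Type II polynomial: for weights $\omega^{(1)},\dots,\omega^{(r+1)}$ on $\mathbb T=\{|z|=1\}$ and multi-index $\vec n=(n_1,\dots,n_{r+1})$ with $n=\sum_j n_j$, $\Phi_{\vec n}$ is the monic polynomial of degree $n$ with $\int_{\mathbb T}\Phi_{\vec n}(z)\overline{z^k}\omega^{(j)}(z)\frac{|dz|}{2\pi}=0$ for $k=0,\dots,n_j-1$, $j=1,\dots,r+1$. Notation: $\theta_j=\frac{\alpha_j+\beta_j}2$, $x_j=e^{i\theta_j}$; $a_\ell=\frac1{\ell\pi}\sin\left(\frac{\ell\Delta}2\right)$ for $\ell\ne0$ and $a_0=\frac{\Delta}{2\pi}$; $l_q=n-r+q-1$ for $1\le q\le r$; $e_k$ is the elementary symmetric polynomial of degree $k$. *)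

theory Defs
  imports "HOL-Analysis.Analysis"
begin

text \<open>
  The integral of \<open>f\<close> over the unit circle against \<open>|dz| / (2 \<pi>)\<close>, parametrized by
  \<open>z = cis \<theta>\<close> with \<open>\<theta>\<close> in \<open>[0, 2 \<pi>)\<close>.
\<close>
definition circle_integral :: "(complex \<Rightarrow> complex) \<Rightarrow> complex" where
  "circle_integral f = (LINT \<theta>:{0..<2 * pi}|lborel. f (cis \<theta>)) / of_real (2 * pi)"

text \<open>
  \<open>\<Phi>\<close> is a type II multiple orthogonal polynomial for the weights \<open>\<omega> 1, \<dots>, \<omega> s\<close> on the unit
  circle and the multi-index \<open>(m 1, \<dots>, m s)\<close>. Uniqueness is not part of the definition.
  The weights are meant to be integrable: the Bochner integral of a non-integrable function is 0.
\<close>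
definition type_II_mop ::
    "nat \<Rightarrow> (nat \<Rightarrow> complex \<Rightarrow> real) \<Rightarrow> (nat \<Rightarrow> nat) \<Rightarrow> complex poly \<Rightarrow> bool" where
  "type_II_mop s \<omega> m \<Phi> \<longleftrightarrow>
     degree \<Phi> = (\<Sum>j=1..s. m j) \<and> lead_coeff \<Phi> = 1 \<and>
     (\<forall>j\<in>{1..s}. \<forall>k<m j.
        circle_integral (\<lambda>z. poly \<Phi> z * cnj (z ^ k) * of_real (\<omega> j z)) = 0)"

text \<open>The \<open>l\<close>-th Fourier coefficient of the indicator of an arc of length \<open>\<Delta>\<close> centred at 1.\<close>
definition arc_coeff :: "real \<Rightarrow> int \<Rightarrow> real" where
  "arc_coeff \<Delta> l =
     (if l = 0 then \<Delta> / (2 * pi) else 1 / (of_int l * pi) * sin (of_int l * \<Delta> / 2))"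

text \<open>The elementary symmetric polynomial of degree \<open>k\<close> in the variables \<open>x i\<close>, \<open>i \<in> I\<close>.\<close>
definition elem_sym :: "nat \<Rightarrow> ('i \<Rightarrow> 'a::comm_semiring_1) \<Rightarrow> 'i set \<Rightarrow> 'a" where
  "elem_sym k x I = (\<Sum>J | J \<subseteq> I \<and> card J = k. \<Prod>i\<in>J. x i)"

end

theory Submission
  imports Defs "HOL-Computational_Algebra.Fundamental_Theorem_Algebra"
begin

text \<open>
  Orthogonality to the constant weight kills the coefficients of \<open>\<Phi>\<close> below \<open>n - r\<close>. The \<open>k\<close>-th moment
  of the arc with midpoint \<open>x j\<close> is \<open>a k * x j ^ k\<close>, so the remaining \<open>r\<close> conditions say that the
  polynomial with the coefficients of \<open>\<Phi>\<close> from \<open>n - r\<close> to \<open>n\<close>, each multiplied by its \<open>a k\<close>,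
  vanishes at \<open>x 1, \<dots>, x r\<close>. Having degree \<open>r\<close> and leading coefficient \<open>a n\<close>, it is \<open>a n\<close> times
  the product of the factors \<open>X - x j\<close>, and Vieta's formulas give \<open>\<Phi>\<close>. Since \<open>\<Delta>\<close> is not a rational
  multiple of \<open>\<pi>\<close>, no \<open>a k\<close> with \<open>k > 0\<close> vanishes. Vieta's formulas in the nonzero zeros of \<open>\<Phi>\<close>
  yield the lower bounds.
\<close>

section \<open>Vieta's formulas and the size of elementary symmetric polynomials\<close>

lemma coeff_prod_linear_factors:
  fixes x :: "'i \<Rightarrow> 'a::comm_ring_1"
  assumes "finite I" "i \<le> card I"
  shows "coeff (\<Prod>j\<in>I. [:- x j, 1:]) i = (-1) ^ (card I - i) * elem_sym (card I - i) x I"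
proof -
  let ?k = "card I - i"
  have "(\<Prod>j\<in>I. [:- x j, 1:]) = (\<Prod>j\<in>I. monom 1 1 - [:x j:])"
    by (simp add: monom_altdef)
  \<comment> \<open>Expand the product: \<open>X\<close> is the set of factors that contribute their
    constant term, and each of the others contributes one power of the variable.\<close>
  also have "\<dots> = (\<Sum>X\<in>Pow I. (-1) ^ card X * (\<Prod>j\<in>X. [:x j:]) * (\<Prod>j\<in>I-X. monom 1 1))"
    by (rule prod_diff_conv_sum) fact
  also have "\<dots> = (\<Sum>X\<in>Pow I. monom ((-1) ^ card X * (\<Prod>j\<in>X. x j)) (card I - card X))"
  proof (intro sum.cong refl)
    fix X assume "X \<in> Pow I"
    then have X: "finite X" "card (I - X) = card I - card X"
      using assms(1) by (auto intro: finite_subset card_Diff_subset)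
    have "(\<Prod>j\<in>X. [:x j:]) = [:\<Prod>j\<in>X. x j:]"
      using X(1) by (induction X rule: finite_induct) (simp_all add: one_pCons)
    moreover have "(-1 :: 'a poly) ^ card X = [:(-1) ^ card X:]"
      by (metis (no_types) poly_const_pow one_pCons minus_pCons minus_zero)
    ultimately show "(-1) ^ card X * (\<Prod>j\<in>X. [:x j:]) * (\<Prod>j\<in>I-X. monom 1 1) =
        monom ((-1) ^ card X * (\<Prod>j\<in>X. x j)) (card I - card X)"
      using X(2) by (simp add: monom_power smult_monom)
  qed
  finally have "coeff (\<Prod>j\<in>I. [:- x j, 1:]) i =
      (\<Sum>X\<in>Pow I. if card I - card X = i then (-1) ^ card X * (\<Prod>j\<in>X. x j) else 0)"
    by (simp add: coeff_sum)
  \<comment> \<open>As \<open>i \<le> card I\<close>, the truncated difference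
    \<open>card I - card X\<close> equals \<open>i\<close> exactly when
    \<open>card X = card I - i\<close>.\<close>
  also have "\<dots> = (\<Sum>X\<in>{X. X \<subseteq> I \<and> card X = ?k}. (-1) ^ card X * (\<Prod>j\<in>X. x j))"
  proof (rule sum.mono_neutral_cong_right)
    show "finite (Pow I)" using assms by simp
    show "\<forall>X\<in>Pow I - {X. X \<subseteq> I \<and> card X = ?k}.
        (if card I - card X = i then (-1) ^ card X * (\<Prod>j\<in>X. x j) else 0) = 0"
    proof
      fix X assume "X \<in> Pow I - {X. X \<subseteq> I \<and> card X = ?k}"
      moreover from this have "card X \<le> card I" using assms by (auto intro: card_mono)
      ultimately have "card I - card X \<noteq> i" by auto
      then show "(if card I - card X = i then (-1) ^ card X * (\<Prod>j\<in>X. x j) else 0) = 0" by simp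
    qed
  qed (use assms in auto)
  also have "\<dots> = (-1) ^ ?k * elem_sym ?k x I"
    by (simp add: elem_sym_def sum_distrib_left)
  finally show ?thesis .
qed

lemma norm_elem_sym_le:
  fixes x :: "'i \<Rightarrow> 'a::{comm_ring_1, real_normed_div_algebra}"
  assumes "finite I" "\<And>i. i \<in> I \<Longrightarrow> norm (x i) \<le> M"
  shows "norm (elem_sym k x I) \<le> real (card I choose k) * M ^ k"
proof -
  have "norm (elem_sym k x I) \<le> (\<Sum>J | J \<subseteq> I \<and> card J = k. M ^ k)"
    unfolding elem_sym_def
  proof (rule sum_norm_le)
    fix J assume J: "J \<in> {J. J \<subseteq> I \<and> card J = k}"
    have "norm (\<Prod>i\<in>J. x i) = (\<Prod>i\<in>J. norm (x i))"
      by (simp add: prod_norm)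
    also have "\<dots> \<le> (\<Prod>i\<in>J. M)"
      using J assms(2) by (intro prod_mono) auto
    finally show "norm (\<Prod>i\<in>J. x i) \<le> M ^ k" using J by simp
  qed
  then show ?thesis using assms(1) by (simp add: n_subsets)
qed

section \<open>Fourier moments of arcs\<close>

lemma set_integral_cis:
  assumes "a \<le> b"
  shows "(LINT \<theta>:{a..b}|lborel. cis (of_int d * \<theta>)) =
    of_real (2 * pi * arc_coeff (b - a) d) * cis (of_int d * ((a + b) / 2))"
proof (cases "d = 0")
  case True
  then show ?thesis
    using assms by (simp add: arc_coeff_def set_lebesgue_integral_def scaleR_conv_of_real)
next
  case False
  define F where "F \<theta> = cis (of_int d * \<theta>) / (\<i> * of_int d)" for \<theta> :: real
  have "(LINT \<theta>:{a..b}|lborel. cis (of_int d * \<theta>)) = F b - F a"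
    unfolding set_lebesgue_integral_def
  proof (rule integral_FTC_atLeastAtMost[OF assms])
    fix \<theta> :: real
    show "(F has_vector_derivative cis (of_int d * \<theta>)) (at \<theta> within {a..b})"
      unfolding F_def has_vector_derivative_def using False
      by (auto intro!: derivative_eq_intros simp: scaleR_conv_of_real fun_eq_iff mult_ac)
  qed (intro continuous_intros)
  also have "\<dots> = (cis (of_int d * b) - cis (of_int d * a)) / (\<i> * of_int d)"
    by (simp add: F_def diff_divide_distrib)
  \<comment> \<open>Centring at the midpoint phase \<open>u\<close> turns the difference into twice
    \<open>\<i>\<close> times the sine of the half-width phase \<open>v\<close>; this is where the
    factor \<open>x j ^ k\<close> in the moments comes from.\<close>
  also have "cis (of_int d * b) - cis (of_int d * a) =
      2 * \<i> * of_real (sin (of_int d * (b - a) / 2)) * cis (of_int d * ((a + b) / 2))"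
  proof -
    define u v where "u = of_int d * ((a + b) / 2)" and "v = of_int d * (b - a) / 2"
    have "of_int d * b = u + v" "of_int d * a = u - v"
      by (simp_all add: u_def v_def field_simps)
    then show ?thesis
      unfolding u_def[symmetric] v_def[symmetric]
      by (simp add: complex_eq_iff cos_add cos_diff sin_add sin_diff)
  qed
  finally show ?thesis using False by (simp add: arc_coeff_def field_simps)
qed

text \<open>The full circle is an arc of length \<open>2 * pi\<close>, so orthogonality of the
  characters is a case of the arc formula: the sine is taken at an integer multiple of
  \<open>pi\<close>.\<close>

lemma arc_coeff_2pi: "arc_coeff (2 * pi) d = (if d = 0 then 1 else 0)"
  by (simp add: arc_coeff_def sin_zero_iff_int2)

text \<open>On the unit circle the conjugate of \<open>z ^ k\<close> is \<open>z\<close> to the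
  power \<open>-k\<close>, so the integral splits into arc moments of order \<open>i - k\<close>.
  The set \<open>S\<close> may or may not contain the endpoint \<open>b\<close>, which has measure
  zero; thus one statement covers both the half-open full circle and the closed arcs.\<close>

lemma circle_integral_poly_arc:
  assumes "a \<le> b" "S \<subseteq> {0..<2 * pi}" "{a..<b} \<subseteq> S" "S \<subseteq> {a..b}"
    and w: "\<And>\<theta>. \<theta> \<in> {0..<2 * pi} \<Longrightarrow> w (cis \<theta>) = indicator S \<theta>"
  shows "circle_integral (\<lambda>z. poly p z * cnj (z ^ k) * of_real (w z)) =
    (\<Sum>i\<le>degree p. coeff p i * of_real (arc_coeff (b - a) (int i - int k))
                      * cis (of_int (int i - int k) * ((a + b) / 2)))"
proof -
  let ?e = "\<lambda>i \<theta>. cis (of_int (int i - int k) * \<theta>)"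
  have "(LINT \<theta>:{0..<2 * pi}|lborel. poly p (cis \<theta>) * cnj (cis \<theta> ^ k) * of_real (w (cis \<theta>))) =
      (LINT \<theta>:S|lborel. \<Sum>i\<le>degree p. coeff p i * ?e i \<theta>)"
    unfolding set_lebesgue_integral_def
  proof (intro Bochner_Integration.integral_cong refl)
    fix \<theta> :: real
    have "poly p (cis \<theta>) * cnj (cis \<theta> ^ k) = (\<Sum>i\<le>degree p. coeff p i * ?e i \<theta>)"
      unfolding poly_altdef sum_distrib_right
      by (intro sum.cong refl)
         (simp add: Complex.DeMoivre cis_cnj cis_mult mult.assoc algebra_simps)
    then show "indicator {0..<2 * pi} \<theta> *\<^sub>R
        (poly p (cis \<theta>) * cnj (cis \<theta> ^ k) * of_real (w (cis \<theta>))) =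
        indicator S \<theta> *\<^sub>R (\<Sum>i\<le>degree p. coeff p i * ?e i \<theta>)"
      using assms(2) w[of \<theta>] by (auto simp: indicator_def)
  qed
  also have "\<dots> = (LINT \<theta>:{a..b}|lborel. \<Sum>i\<le>degree p. coeff p i * ?e i \<theta>)"
    using assms(3,4) by (intro set_integral_discrete_difference[where X = "{b}"]) (auto simp: subset_iff)
  also have "\<dots> = (\<Sum>i\<le>degree p. coeff p i * (LINT \<theta>:{a..b}|lborel. ?e i \<theta>))"
  proof -
    have "set_integrable lborel {a..b} (\<lambda>\<theta>. coeff p i * ?e i \<theta>)" for i
      by (intro borel_integrable_atLeastAtMost' continuous_intros)
    then show ?thesis
      by (simp add: set_integrable_def set_lebesgue_integral_def scaleR_sum_right
            Bochner_Integration.integral_sum flip: integral_mult_right_zero mult_scaleR_right)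
  qed
  finally show ?thesis
    unfolding circle_integral_def set_integral_cis[OF assms(1)]
    by (simp add: sum_divide_distrib mult.assoc)
qed

text \<open>By Vieta the coefficient is, up to sign, the elementary symmetric polynomial of degree
  \<open>k = card I - i\<close> in the roots. It has \<open>card I choose k\<close> terms, each of
  norm at most \<open>M ^ k\<close> for the largest root norm \<open>M\<close>; taking
  \<open>k\<close>-th roots gives the bound.\<close>

lemma Max_norm_roots_ge:
  fixes \<zeta> :: "'i \<Rightarrow> 'a::real_normed_field"
  assumes "finite I" "i < card I"
  shows "(norm (coeff (\<Prod>j\<in>I. [:- \<zeta> j, 1:]) i) / real (card I choose i)) powr (1 / real (card I - i))
    \<le> Max ((\<lambda>j. norm (\<zeta> j)) ` I)"
proof -
  define M where "M = Max ((\<lambda>j. norm (\<zeta> j)) ` I)"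
  define k where "k = card I - i"
  have le: "norm (\<zeta> j) \<le> M" if "j \<in> I" for j
    unfolding M_def using that assms(1) by auto
  obtain j where "j \<in> I" using assms by fastforce
  then have "0 \<le> M" using le[of j] norm_ge_zero[of "\<zeta> j"] by linarith
  have k_pos: "k > 0" and k_sym: "card I choose k = card I choose i"
    using assms binomial_symmetric[of i "card I"] by (simp_all add: k_def)
  have "norm (coeff (\<Prod>j\<in>I. [:- \<zeta> j, 1:]) i) = norm (elem_sym k \<zeta> I)"
    using assms by (simp add: coeff_prod_linear_factors k_def norm_mult norm_power)
  also have "\<dots> \<le> real (card I choose i) * M ^ k"
    using norm_elem_sym_le[OF assms(1) le, where k = k] k_sym by simp
  finally have "norm (coeff (\<Prod>j\<in>I. [:- \<zeta> j, 1:]) i) / real (card I choose i) \<le> M ^ k"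
    using assms by (simp add: divide_le_eq mult.commute)
  then have "(norm (coeff (\<Prod>j\<in>I. [:- \<zeta> j, 1:]) i) / real (card I choose i)) powr (1 / real k)
      \<le> (M ^ k) powr (1 / real k)"
    by (intro powr_mono2) auto
  \<comment> \<open>The case \<open>M = 0\<close> is separate because rewriting \<open>M ^ k\<close>
    as a \<open>powr\<close> requires a positive base.\<close>
  also have "(M ^ k) powr (1 / real k) = M"
    using k_pos \<open>0 \<le> M\<close> by (cases "M = 0") (simp_all add: powr_powr flip: powr_realpow)
  finally show ?thesis by (simp add: M_def k_def)
qed

text \<open>The algebraic core: weighting the coefficients by \<open>A\<close> turns the conditions
  at the \<open>x j\<close> into ordinary root conditions, and a polynomial of degree
  \<open>r\<close> is determined by \<open>r\<close> distinct roots and its leading coefficient.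
  Dividing the weights out again gives \<open>S\<close>. The equivalence provides existence and
  uniqueness together.\<close>

lemma monic_annihilated_iff:
  fixes \<Phi> S :: "'a::field poly" and x :: "'i \<Rightarrow> 'a" and A :: "nat \<Rightarrow> 'a"
  assumes I: "finite I" "card I = r" "inj_on x I" and x: "\<And>j. j \<in> I \<Longrightarrow> x j \<noteq> 0"
    and A: "\<And>i. i \<le> r \<Longrightarrow> A (N + i) \<noteq> 0"
    and S: "\<And>i. coeff S i = A (N + r) / A (N + i) * coeff (\<Prod>j\<in>I. [:- x j, 1:]) i"
  shows "degree \<Phi> = N + r \<and> lead_coeff \<Phi> = 1 \<and> (\<forall>k<N. coeff \<Phi> k = 0) \<and>
      (\<forall>j\<in>I. (\<Sum>i\<le>N + r. coeff \<Phi> i * A i * x j ^ i) = 0) \<longleftrightarrow>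
    \<Phi> = monom 1 N * S" (is "?L \<longleftrightarrow> ?R")
proof -
  define P where "P = (\<Prod>j\<in>I. [:- x j, 1:])"
  have degP: "degree P = r" "coeff P r = 1"
  proof -
    show "degree P = r" unfolding P_def using I by (simp add: degree_prod_eq_sum_degree)
    have "lead_coeff P = 1" unfolding P_def by (simp add: lead_coeff_prod)
    then show "coeff P r = 1" using \<open>degree P = r\<close> by simp
  qed
  have rootP: "poly P (x j) = 0" if "j \<in> I" for j
    using that I(1) by (auto simp: P_def poly_prod)
  \<comment> \<open>Vanishing low coefficients allow the factor \<open>y ^ N\<close> to be taken
    out; at a nonzero \<open>x j\<close> it can be cancelled.\<close>
  have shift: "(\<Sum>i\<le>N + r. coeff \<Phi> i * A i * y ^ i) =
      y ^ N * (\<Sum>i\<le>r. coeff \<Phi> (N + i) * A (N + i) * y ^ i)" if "\<forall>k<N. coeff \<Phi> k = 0" for y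
  proof -
    have "(\<Sum>i\<le>N + r. coeff \<Phi> i * A i * y ^ i) = (\<Sum>i\<in>{N..N + r}. coeff \<Phi> i * A i * y ^ i)"
      using that by (intro sum.mono_neutral_right) auto
    also have "\<dots> = (\<Sum>i\<in>{0..r}. coeff \<Phi> (i + N) * A (i + N) * y ^ (i + N))"
      using sum.shift_bounds_cl_nat_ivl[of "\<lambda>i. coeff \<Phi> i * A i * y ^ i" 0 N r]
      by (simp add: add.commute)
    finally show ?thesis
      by (simp add: sum_distrib_left power_add atLeast0AtMost algebra_simps)
  qed
  show ?thesis
  proof
    assume L: ?L
    define T where "T = (\<Sum>i\<le>r. monom (coeff \<Phi> (N + i) * A (N + i)) i)"
    have coeffT: "coeff T i = (if i \<le> r then coeff \<Phi> (N + i) * A (N + i) else 0)" for i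
      by (simp add: T_def coeff_sum)
    \<comment> \<open>Both sides have degree at most \<open>r\<close>, the same coefficient at
      \<open>r\<close> since \<Phi> is monic, and vanish at the \<open>r\<close> distinct points
      \<open>x j\<close>.\<close>
    have "T = smult (A (N + r)) P"
    proof (rule poly_eqI_degree_lead_coeff[where A = "x ` I" and n = r])
      show "coeff T r = coeff (smult (A (N + r)) P) r" using L degP by (metis coeffT coeff_smult le_refl mult_1 mult_1_right)
      show "degree T \<le> r" by (rule degree_le) (simp add: coeffT)
      show "degree (smult (A (N + r)) P) \<le> r" using degP by (simp add: degree_smult_le)
      show "r \<le> card (x ` I)" using I by (simp add: card_image)
      fix z assume "z \<in> x ` I"
      then obtain j where j: "j \<in> I" "z = x j" by auto
      then have "x j ^ N * poly T (x j) = 0"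
        using L shift[of "x j"] by (simp add: T_def poly_sum poly_monom)
      then show "poly T z = poly (smult (A (N + r)) P) z"
        using x[OF j(1)] rootP[OF j(1)] j(2) by simp
    qed
    then have "coeff \<Phi> (N + i) = coeff S i" if "i \<le> r" for i
      using coeffT[of i] that A[OF that] S[of i] by (simp add: P_def field_simps)
    moreover have "coeff \<Phi> (N + i) = coeff S i" if "i > r" for i
      using L that degP S[of i] by (simp add: coeff_eq_0 flip: P_def)
    ultimately have "coeff \<Phi> (N + i) = coeff S i" for i
      using linorder_not_less by blast
    then have "coeff \<Phi> n = coeff S (n - N)" if "n \<ge> N" for n
      using that by (metis le_add_diff_inverse)
    then show ?R
      using L by (intro poly_eqI) (simp add: coeff_monom_mult)
  next
    assume R: ?R
    have c: "coeff \<Phi> (N + i) = coeff S i" for i using R by (simp add: coeff_monom_mult)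
    have low: "\<forall>k<N. coeff \<Phi> k = 0" using R by (simp add: coeff_monom_mult)
    have top: "coeff \<Phi> (N + r) = 1" using c[of r] S[of r] A[of r] degP by (simp flip: P_def)
    have "coeff \<Phi> k = 0" if "k > N + r" for k
      using R that degP S by (simp add: coeff_monom_mult coeff_eq_0 flip: P_def)
    then have deg: "degree \<Phi> = N + r"
      using top by (intro antisym degree_le le_degree) auto
    have "(\<Sum>i\<le>N + r. coeff \<Phi> i * A i * x j ^ i) = 0" if "j \<in> I" for j
    proof -
      \<comment> \<open>The weight \<open>A (N + i)\<close> cancels the denominator in
        \<open>coeff S i\<close>, which leaves a multiple of \<open>P\<close>.\<close>
      have "(\<Sum>i\<le>r. coeff \<Phi> (N + i) * A (N + i) * x j ^ i) = A (N + r) * poly P (x j)"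
        unfolding poly_altdef sum_distrib_left degP
        using A by (intro sum.cong) (simp_all add: c S flip: P_def)
      then show ?thesis using shift[OF low] rootP[OF that] by simp
    qed
    then show ?L using deg top low by simp
  qed
qed

text \<open>A zero of the sine would give \<open>\<Delta> = 2 * d * pi / i\<close> for some integer
  \<open>d\<close>, a rational multiple of \<open>pi\<close>.\<close>

lemma arc_coeff_ne_0:
  assumes "\<Delta> \<notin> (\<lambda>t. pi * t) ` \<rat>" "i > 0"
  shows "arc_coeff \<Delta> (int i) \<noteq> 0"
proof
  assume "arc_coeff \<Delta> (int i) = 0"
  then have "sin (real i * \<Delta> / 2) = 0" using assms(2) by (simp add: arc_coeff_def)
  then obtain d :: int where "real i * \<Delta> / 2 = of_int d * pi"
    by (auto simp: sin_zero_iff_int2)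
  then have "\<Delta> = pi * (of_int (2 * d) / of_nat i)"
    using assms(2) by (simp add: field_simps)
  moreover have "of_int (2 * d) / of_nat i \<in> (\<rat> :: real set)"
    by (intro Rats_divide) auto
  ultimately show False using assms(1) by blast
qed

lemma monic_complex_poly_linear_factors:
  fixes Q :: "complex poly"
  assumes "lead_coeff Q = 1"
  obtains \<zeta> where "Q = (\<Prod>j\<in>{1..degree Q}. [:- \<zeta> j, 1:])"
proof -
  obtain root where "Q = (\<Prod>i<degree Q. [:- root i, 1:])"
    using complex_poly_decompose'[of Q] assms by (metis smult_1_left)
  also have "\<dots> = (\<Prod>j\<in>{1..degree Q}. [:- root (j - 1), 1:])"
    by (simp add: prod.atLeast1_atMost_eq)
  finally show ?thesis by (rule that)
qed

text \<open>Every midpoint lies in its own interval, hence in \<open>{0..<2 * pi}\<close>, where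
  \<open>Arg2pi\<close> recovers the angle from \<open>cis\<close>. Equal points thus have equal
  angles, which would lie in two disjoint intervals if the indices differed.\<close>

lemma arc_midpoints_inj:
  fixes \<alpha> \<beta> :: "'i \<Rightarrow> real"
  assumes sub: "\<And>j. j \<in> I \<Longrightarrow> {\<alpha> j..\<beta> j} \<subseteq> {0..<2 * pi}"
    and disj: "disjoint_family_on (\<lambda>j. {\<alpha> j..\<beta> j}) I"
    and le: "\<And>j. j \<in> I \<Longrightarrow> \<alpha> j \<le> \<beta> j"
  shows "inj_on (\<lambda>j. cis ((\<alpha> j + \<beta> j) / 2)) I"
proof (rule inj_onI)
  fix i j assume ij: "i \<in> I" "j \<in> I" and eq: "cis ((\<alpha> i + \<beta> i) / 2) = cis ((\<alpha> j + \<beta> j) / 2)"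
  have mid: "(\<alpha> k + \<beta> k) / 2 \<in> {\<alpha> k..\<beta> k}" if "k \<in> I" for k using le[OF that] by simp
  then have "Arg2pi (cis ((\<alpha> k + \<beta> k) / 2)) = (\<alpha> k + \<beta> k) / 2" if "k \<in> I" for k
    using sub[OF that] that by (intro Arg2pi_unique[of 1]) (force simp: cis_conv_exp)+
  then have "(\<alpha> i + \<beta> i) / 2 = (\<alpha> j + \<beta> j) / 2" using eq ij by metis
  then show "i = j"
    using disj mid[OF ij(1)] mid[OF ij(2)] ij unfolding disjoint_family_on_def by (metis IntI empty_iff)
qed

theorem corollary3p8:
  fixes r n :: nat and \<alpha> \<beta> :: "nat \<Rightarrow> real" and \<Delta> :: real
    and \<omega> :: "nat \<Rightarrow> complex \<Rightarrow> real"
    and m :: "nat \<Rightarrow> nat" and x :: "nat \<Rightarrow> complex" and l :: "nat \<Rightarrow> nat"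
  assumes "r \<ge> 1" and "n > r"
    and "\<And>j. j \<in> {1..r} \<Longrightarrow> {\<alpha> j..\<beta> j} \<subseteq> {0..<2 * pi}"
    and "disjoint_family_on (\<lambda>j. {\<alpha> j..\<beta> j}) {1..r}"
    and "\<And>j. j \<in> {1..r} \<Longrightarrow> \<beta> j - \<alpha> j = \<Delta>"
    and "\<Delta> > 0"
    and "\<Delta> \<notin> (\<lambda>t. pi * t) ` \<rat>"
    and "\<And>\<theta>. \<theta> \<in> {0..<2 * pi} \<Longrightarrow> \<omega> 1 (cis \<theta>) = 1"
    and "\<And>j \<theta>. j \<in> {1..r} \<Longrightarrow> \<theta> \<in> {0..<2 * pi} \<Longrightarrow>
           \<omega> (j + 1) (cis \<theta>) = indicator {\<alpha> j..\<beta> j} \<theta>"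
  defines "m \<equiv> \<lambda>j. if j = 1 then n - r else 1"
    and "x \<equiv> \<lambda>j. cis ((\<alpha> j + \<beta> j) / 2)"
    and "l \<equiv> \<lambda>q. n - r + q - 1"
  shows "(\<exists>!\<Phi>. type_II_mop (r + 1) \<omega> m \<Phi>) \<and>
    (\<forall>\<Phi>. type_II_mop (r + 1) \<omega> m \<Phi> \<longrightarrow>
      (\<forall>z. poly \<Phi> z = z ^ n -
         (\<Sum>q=1..r. (of_real (arc_coeff \<Delta> (int n) / arc_coeff \<Delta> (int (l q)))
                      * (-1) ^ (r - q) * elem_sym (r - q + 1) x {1..r}) * z ^ l q)) \<and>
      order 0 \<Phi> = n - r \<and>
      (\<exists>\<zeta> :: nat \<Rightarrow> complex.
         proots \<Phi> = replicate_mset (n - r) 0 + image_mset \<zeta> (mset_set {1..r}) \<and>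
         (\<forall>q\<in>{1..r}.
            Max ((\<lambda>j. cmod (\<zeta> j)) ` {1..r}) \<ge>
              (\<bar>real (n - r + q - 1) / real n *
                 (sin (real n * \<Delta> / 2) / sin (real (n - r + q - 1) * \<Delta> / 2))\<bar>
               * (cmod (elem_sym (r - q + 1) x {1..r}) / real (r choose (q - 1))))
              powr (1 / real (r - q + 1))) \<and>
         Max ((\<lambda>j. cmod (\<zeta> j)) ` {1..r}) \<ge>
           \<bar>real (n - r) / real n *
              (sin (real n * \<Delta> / 2) / sin (real (n - r) * \<Delta> / 2))\<bar>
           powr (1 / real r)))"
proof -

  \<comment> \<open>The candidate polynomial and its nonvanishing constant coefficient\<close>
  define N I where "N = n - r" and "I = {1..r}"
  define A where "A i = complex_of_real (arc_coeff \<Delta> (int i))" for i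
  define P where "P = (\<Prod>j\<in>I. [:- x j, 1:])"
  \<comment> \<open>\<open>S\<close> is what remains of \<Phi> after removing the factor
    \<open>z ^ N\<close>: the coefficients of \<open>P\<close>, normalised by \<open>A n\<close> and
    divided by the weights.\<close>
  define S where "S = (\<Sum>i\<le>r. monom (A n / A (N + i) * coeff P i) i)"
  have N: "N > 0" "N + r = n" using assms(2) by (auto simp: N_def)
  have I: "finite I" "card I = r" by (auto simp: I_def)
  have le: "\<alpha> j \<le> \<beta> j" if "j \<in> I" for j
    using assms(5)[of j] assms(6) that by (simp add: I_def)
  have inj: "inj_on x I"
    unfolding x_def I_def using assms(3,4) le by (intro arc_midpoints_inj) (auto simp: I_def)
  have A: "A i \<noteq> 0" if "i > 0" for i
    using arc_coeff_ne_0[OF assms(7) that] by (simp add: A_def)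
  have degP: "degree P = r"
    unfolding P_def using I by (simp add: degree_prod_eq_sum_degree)
  have coeffP: "coeff P i = (-1) ^ (r - i) * elem_sym (r - i) x I" if "i \<le> r" for i
    unfolding P_def using coeff_prod_linear_factors[OF I(1), of i x] that I(2) by simp
  have coeffS: "coeff S i = A (N + r) / A (N + i) * coeff P i" for i
    using degP N by (simp add: S_def coeff_sum coeff_eq_0)
  have "lead_coeff P = 1"
    unfolding P_def by (simp add: lead_coeff_prod)
  then have S_r: "coeff S r = 1"
    using coeffS[of r] A[of n] N degP assms(2) by simp
  have degS: "degree S = r"
  proof (rule antisym)
    show "degree S \<le> r" by (rule degree_le) (simp add: coeffS coeff_eq_0 degP)
    show "r \<le> degree S" by (rule le_degree) (simp add: S_r)
  qed
  \<comment> \<open>The only subset of size \<open>r\<close> is \<open>I\<close> itself, and each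
    \<open>x j\<close> lies on the unit circle. This makes the constant coefficient of
    \<open>S\<close> nonzero and simplifies the bound for \<open>q = 1\<close>.\<close>
  have norm_e: "cmod (elem_sym r x I) = 1"
  proof -
    have "{J. J \<subseteq> I \<and> card J = r} = {I}" using I by (auto dest: card_subset_eq)
    then show ?thesis by (simp add: elem_sym_def x_def prod_norm[symmetric])
  qed
  then have "coeff P 0 \<noteq> 0"
    using coeffP[of 0] by auto
  then have S_0: "coeff S 0 \<noteq> 0"
    using coeffS[of 0] A[of n] A[of N] N by simp

  \<comment> \<open>Orthogonality conditions as conditions on coefficients\<close>
  have circle: "circle_integral (\<lambda>z. poly \<Phi> z * cnj (z ^ k) * of_real (\<omega> 1 z)) = coeff \<Phi> k" for \<Phi> k
  proof -
    have "circle_integral (\<lambda>z. poly \<Phi> z * cnj (z ^ k) * of_real (\<omega> 1 z)) =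
      (\<Sum>i\<le>degree \<Phi>. coeff \<Phi> i * of_real (arc_coeff (2 * pi - 0) (int i - int k))
                      * cis (of_int (int i - int k) * ((0 + 2 * pi) / 2)))"
      by (intro circle_integral_poly_arc[where S = "{0..<2 * pi}"]) (use assms(8) in auto)
    also have "\<dots> = (\<Sum>i\<le>degree \<Phi>. if i = k then coeff \<Phi> k else 0)"
      by (intro sum.cong refl) (simp add: arc_coeff_2pi)
    also have "\<dots> = coeff \<Phi> k" by (simp add: coeff_eq_0)
    finally show ?thesis .
  qed
  \<comment> \<open>Only the moment with exponent 0 is tested, since \<open>m (j + 1) = 1\<close>;
    the phase of the midpoint becomes \<open>x j ^ i\<close> by de Moivre.\<close>
  have arc: "circle_integral (\<lambda>z. poly \<Phi> z * cnj (z ^ 0) * of_real (\<omega> (j + 1) z)) =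
      (\<Sum>i\<le>degree \<Phi>. coeff \<Phi> i * A i * x j ^ i)" if "j \<in> I" for \<Phi> j
  proof -
    have j: "j \<in> {1..r}" using that by (simp add: I_def)
    show ?thesis
      unfolding A_def x_def Complex.DeMoivre assms(5)[OF j, symmetric]
      using circle_integral_poly_arc[where S = "{\<alpha> j..\<beta> j}" and w = "\<omega> (j + 1)" and p = \<Phi>
          and k = 0, OF le[OF that] assms(3)[OF j] _ _ assms(9)[OF j]]
      by (simp add: atLeastLessThan_subseteq_atLeastAtMost_iff)
  qed
  have mop_iff: "type_II_mop (r + 1) \<omega> m \<Phi> \<longleftrightarrow> \<Phi> = monom 1 N * S" for \<Phi>
  proof -
    have "{1..r + 1} = insert 1 (Suc ` I)"
      by (auto simp: I_def image_Suc_atLeastAtMost)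
    then have orth: "(\<forall>j\<in>{1..r + 1}. Q j) \<longleftrightarrow> Q 1 \<and> (\<forall>j\<in>I. Q (j + 1))" for Q :: "nat \<Rightarrow> bool"
      by auto
    have "(\<Sum>j=1..r + 1. m j) = m 1 + (\<Sum>j\<in>I. m (j + 1))"
      by (simp add: I_def sum.atLeast_Suc_atMost flip: sum.shift_bounds_cl_Suc_ivl)
    also have "(\<Sum>j\<in>I. m (j + 1)) = r"
      using I by (subst sum.cong[where h = "\<lambda>_. 1"]) (auto simp: m_def I_def)
    finally have deg: "(\<Sum>j=1..r + 1. m j) = N + r" by (simp add: m_def N_def)
    have m1: "m 1 = N" and mj: "j \<in> I \<Longrightarrow> m (j + 1) = 1" for j
      by (auto simp: m_def N_def I_def)
    have "type_II_mop (r + 1) \<omega> m \<Phi> \<longleftrightarrow>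
        degree \<Phi> = N + r \<and> lead_coeff \<Phi> = 1 \<and> (\<forall>k<N. coeff \<Phi> k = 0) \<and>
        (\<forall>j\<in>I. (\<Sum>i\<le>degree \<Phi>. coeff \<Phi> i * A i * x j ^ i) = 0)"
      unfolding type_II_mop_def orth deg m1 circle using arc[of _ \<Phi>] mj by simp
    \<comment> \<open>The degree conjunct fixes the upper limit of the sums.\<close>
    also have "\<dots> \<longleftrightarrow> degree \<Phi> = N + r \<and> lead_coeff \<Phi> = 1 \<and> (\<forall>k<N. coeff \<Phi> k = 0) \<and>
        (\<forall>j\<in>I. (\<Sum>i\<le>N + r. coeff \<Phi> i * A i * x j ^ i) = 0)"
      by auto
    also have "\<dots> \<longleftrightarrow> \<Phi> = monom 1 N * S"
      using I inj A N coeffS unfolding P_def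
      by (intro monic_annihilated_iff) (auto simp: x_def)
    finally show ?thesis .
  qed

  \<comment> \<open>The explicit formula\<close>
  have eval: "poly (monom 1 N * S) z = z ^ n -
      (\<Sum>q=1..r. (of_real (arc_coeff \<Delta> (int n) / arc_coeff \<Delta> (int (l q)))
                      * (-1) ^ (r - q) * elem_sym (r - q + 1) x {1..r}) * z ^ l q)" for z
  proof -
    have "poly (monom 1 N * S) z = (\<Sum>i\<le>r. coeff S i * z ^ (N + i))"
      by (simp add: poly_monom poly_altdef[of S] degS sum_distrib_left power_add mult_ac)
    also have "\<dots> = z ^ n + (\<Sum>i<r. coeff S i * z ^ (N + i))"
      by (simp add: S_r N flip: lessThan_Suc_atMost)
    also have "(\<Sum>i<r. coeff S i * z ^ (N + i)) = (\<Sum>q=1..r. coeff S (q - 1) * z ^ l q)"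
      by (simp add: sum.atLeast1_atMost_eq l_def N_def)
    \<comment> \<open>With \<open>i = q - 1\<close>, Vieta's sign is
      \<open>(-1) ^ (r - q + 1)\<close>; its extra factor is the minus sign in front of the
      sum.\<close>
    also have "\<dots> = (\<Sum>q=1..r. - (of_real (arc_coeff \<Delta> (int n) / arc_coeff \<Delta> (int (l q)))
                      * (-1) ^ (r - q) * elem_sym (r - q + 1) x {1..r} * z ^ l q))"
    proof (intro sum.cong refl)
      fix q assume q: "q \<in> {1..r}"
      then have "r - (q - 1) = Suc (r - q)" "N + (q - 1) = l q" "q - 1 \<le> r"
        by (auto simp: l_def N_def)
      then show "coeff S (q - 1) * z ^ l q =
          - (of_real (arc_coeff \<Delta> (int n) / arc_coeff \<Delta> (int (l q)))
                      * (-1) ^ (r - q) * elem_sym (r - q + 1) x {1..r} * z ^ l q)"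
        using coeffS[of "q - 1"] coeffP[of "q - 1"] N by (simp add: A_def I_def)
    qed
    finally show ?thesis by (simp add: sum_negf)
  qed

  \<comment> \<open>Zeros and their multiplicities\<close>
  have "S \<noteq> 0" using S_0 by auto
  \<comment> \<open>\<open>S\<close> does not vanish at the origin, so the whole multiplicity there
    comes from \<open>monom 1 N\<close>.\<close>
  have order: "order 0 (monom 1 N * S) = N"
    using \<open>S \<noteq> 0\<close> S_0 by (subst order_mult) (auto simp: order_0I poly_0_coeff_0)

  obtain \<zeta> where \<zeta>: "S = (\<Prod>j\<in>I. [:- \<zeta> j, 1:])"
    using monic_complex_poly_linear_factors[of S] S_r by (auto simp: degS I_def)
  have roots: "proots (monom 1 N * S) = replicate_mset N 0 + image_mset \<zeta> (mset_set I)"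
  proof -
    have "proots (monom (1::complex) N) = replicate_mset N 0"
      using proots_linear_factor[of "0::complex"] by (simp add: monom_altdef proots_power)
    moreover have "proots S = image_mset \<zeta> (mset_set I)"
      unfolding \<zeta> by (subst proots_prod) (simp_all add: sum_unfold_sum_mset)
    ultimately show ?thesis using \<open>S \<noteq> 0\<close> by (simp add: proots_mult)
  qed

  \<comment> \<open>Lower bounds for the largest zero\<close>
  have bound: "Max ((\<lambda>j. cmod (\<zeta> j)) ` {1..r}) \<ge>
      (\<bar>real (n - r + q - 1) / real n *
         (sin (real n * \<Delta> / 2) / sin (real (n - r + q - 1) * \<Delta> / 2))\<bar>
       * (cmod (elem_sym (r - q + 1) x {1..r}) / real (r choose (q - 1))))
      powr (1 / real (r - q + 1))" if q: "q \<in> {1..r}" for q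
  proof -
    have q': "r - (q - 1) = r - q + 1" "N + (q - 1) = n - r + q - 1" "q - 1 < r" "n - r + q - 1 > 0"
      using q N by (auto simp: N_def)
    have "cmod (coeff S (q - 1)) =
        \<bar>arc_coeff \<Delta> (int n) / arc_coeff \<Delta> (int (n - r + q - 1))\<bar> * cmod (elem_sym (r - q + 1) x I)"
      unfolding coeffS coeffP[OF less_imp_le[OF q'(3)]] N(2) q'(1,2) A_def
      by (simp add: norm_mult norm_divide norm_power)
    \<comment> \<open>Both indices are positive, so the nonzero branch of \<open>arc_coeff\<close>
      applies and the factors \<open>pi\<close> cancel.\<close>
    also have "arc_coeff \<Delta> (int n) / arc_coeff \<Delta> (int (n - r + q - 1)) =
        real (n - r + q - 1) / real n *
         (sin (real n * \<Delta> / 2) / sin (real (n - r + q - 1) * \<Delta> / 2))"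
      using q'(4) N by (simp add: arc_coeff_def)
    finally have norm_c: "cmod (coeff S (q - 1)) =
        \<bar>real (n - r + q - 1) / real n *
         (sin (real n * \<Delta> / 2) / sin (real (n - r + q - 1) * \<Delta> / 2))\<bar>
       * cmod (elem_sym (r - q + 1) x I)" .
    have "q - 1 < card I" using q' I by simp
    from Max_norm_roots_ge[OF I(1) this, of \<zeta>, folded \<zeta>, unfolded norm_c I(2) q'(1)]
    show ?thesis
      unfolding times_divide_eq_right I_def .
  qed
  have bound1: "Max ((\<lambda>j. cmod (\<zeta> j)) ` {1..r}) \<ge>
      \<bar>real (n - r) / real n * (sin (real n * \<Delta> / 2) / sin (real (n - r) * \<Delta> / 2))\<bar> powr (1 / real r)"
    using bound[of 1] norm_e assms(1) by (simp add: I_def)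

  \<comment> \<open>By \<open>mop_iff\<close> the polynomial is given by an equation, so unique
    existence is immediate and the other claims concern \<open>monom 1 N * S\<close> alone.\<close>
  show ?thesis
    unfolding mop_iff using eval order roots bound bound1 unfolding N_def I_def by blast
qed

end
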